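(* Let $k$ be an integer with $k\geq 2$, let $n_0$ be a nonnegative integer, and let $A\subseteq\mathbb{N}$ be a set such that $R_{1,k}(A,n)=R_{1,k}(\mathbb{N}\setminus A,n)$ holds for all integers $n\geq n_0$. Then $R_{1,k}(A,n)\gg \log n$; that is, there exist a real constant $c>0$ and an integer $N$ (which may depend on $k$, $n_0$ and $A$) such that $R_{1,k}(A,n)\geq c\log n$ for all integers $n\geq N$.
   Context: $\mathbb{N}$ denotes the set of all nonnegative integers (including $0$). For positive integers $k_1,k_2$, a set $A\subseteq\mathbb{N}$ and $n\in\mathbb{N}$, the weighted representation function $R_{k_1,k_2}(A,n)$ is the number of solutions of the equation $n=k_1a_1+k_2a_2$ with $a_1,a_2\in A$, i.e. the number of ordered pairs $(a_1,a_2)\in A\times A$ with $k_1a_1+k_2a_2=n$. *)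

theory Defs
  imports Complex_Main
begin

text \<open>Ordered pairs are counted. For positive weights the solution set is finite (lemma below), so
  \<open>card\<close> is a genuine count; for a zero weight it could be infinite and \<open>card\<close> would return 0.\<close>

definition weighted_rep :: "nat \<Rightarrow> nat \<Rightarrow> nat set \<Rightarrow> nat \<Rightarrow> nat" where
  "weighted_rep k1 k2 A n =
     card {(a1, a2). a1 \<in> A \<and> a2 \<in> A \<and> n = k1 * a1 + k2 * a2}"

lemma finite_weighted_rep_solutions:
  assumes "k1 > 0" and "k2 > 0"
  shows "finite {(a1, a2). a1 \<in> A \<and> a2 \<in> A \<and> n = k1 * a1 + k2 * (a2 :: nat)}"
proof (rule finite_subset)
  have "a \<le> k1 * a" "a \<le> k2 * a" for a
    using assms by simp_all
  then show "{(a1, a2). a1 \<in> A \<and> a2 \<in> A \<and> n = k1 * a1 + k2 * a2} \<subseteq> {..n} \<times> {..n}"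
    by (auto intro: le_trans trans_le_add1 trans_le_add2)
qed simp

end

theory Submission
  imports Defs
begin

text \<open>
  The count \<open>R(A,n)\<close> even grows linearly; the logarithmic bound is a weakening of that.

  Write \<open>\<epsilon>\<close> for the function that is \<open>1\<close> on \<open>A\<close> and \<open>-1\<close> off \<open>A\<close>. The hypothesis at \<open>n\<close> says that
  \<open>\<epsilon>(b) + \<epsilon>(n - k b)\<close>, summed over all \<open>b \<le> n div k\<close>, vanishes. Subtracting this at \<open>n\<close> from the same
  at \<open>n + k\<close> leaves two terms, \<open>\<epsilon>(n + k) + \<epsilon>((n + k) div k) = 0\<close>. So, beyond a threshold \<open>M\<close>, deleting
  the last base-\<open>k\<close> digit flips membership in \<open>A\<close> (\<open>mem_iff_div_notin\<close>). Hence \<open>\<epsilon>\<close> is constant on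
  each block of numbers that share a quotient \<open>q \<ge> M\<close> by \<open>k ^ i\<close>, with the sign \<open>(-1) ^ i \<epsilon>(q)\<close>
  (\<open>mem_iff_leading_digits\<close>).

  The hypothesis also gives \<open>2 R(A,n) = R(A,n) + R(\<nat> - A,n)\<close>, which is the number of \<open>b \<le> n div k\<close>
  with \<open>\<epsilon>(b) = \<epsilon>(n - k b)\<close>. Near \<open>0\<close> the sign of \<open>\<epsilon>\<close> alternates along the blocks of numbers with
  quotient \<open>M\<close> by \<open>k ^ j\<close> for \<open>j = i, i+1, i+2, i+3\<close>. Near \<open>n\<close>, on the other hand, \<open>\<epsilon>\<close> is constant on
  much longer blocks, so \<open>\<epsilon>(n - k b)\<close> changes at most once while \<open>b\<close> runs through these four blocks.
  Therefore the first two or the last two of them see a constant value of \<open>\<epsilon>(n - k b)\<close>, and one block of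
  that pair consists of agreements only. This gives \<open>2 R(A,n) \<ge> k ^ i\<close> as soon as \<open>n\<close> exceeds a
  constant times \<open>k ^ i\<close> (\<open>power_le_twice_weighted_rep\<close>).
\<close>

section \<open>Counting agreements\<close>

lemma weighted_rep_1_eq_card:
  assumes "k > 0"
  shows "weighted_rep 1 k A n = card {b. b \<le> n div k \<and> b \<in> A \<and> n - k * b \<in> A}"
proof -
  have le_iff: "b \<le> n div k \<longleftrightarrow> k * b \<le> n" for b
    using assms by (simp add: less_eq_div_iff_mult_less_eq mult.commute)
  have "bij_betw (\<lambda>b. (n - k * b, b)) {b. b \<le> n div k \<and> b \<in> A \<and> n - k * b \<in> A}
          {(a1, a2). a1 \<in> A \<and> a2 \<in> A \<and> n = 1 * a1 + k * a2}"
    unfolding le_iff by (rule bij_betw_byWitness[where f' = snd]) auto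
  then show ?thesis
    unfolding weighted_rep_def by (rule bij_betw_same_card[symmetric])
qed

definition set_sign :: "nat set \<Rightarrow> nat \<Rightarrow> int" where
  "set_sign A x = (if x \<in> A then 1 else -1)"

text \<open>The products of indicators of \<open>A\<close> and of its complement differ by a linear expression: the
  quadratic terms cancel, which makes the hypothesis on \<open>A\<close> a linear condition on the signs.\<close>

lemma sum_set_sign_eq_weighted_rep_diff:
  assumes "k > 0"
  shows "(\<Sum>b\<le>n div k. set_sign A b + set_sign A (n - k * b)) =
           2 * (int (weighted_rep 1 k A n) - int (weighted_rep 1 k (UNIV - A) n))"
proof -
  have card_sum: "int (weighted_rep 1 k B n) = (\<Sum>b\<le>n div k. of_bool (b \<in> B \<and> n - k * b \<in> B))" for B
    unfolding weighted_rep_1_eq_card[OF assms] by (simp add: Int_def conj_commute)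
  show ?thesis
    unfolding card_sum sum_subtractf[symmetric] sum_distrib_left
    by (rule sum.cong) (auto simp: set_sign_def)
qed

lemma card_agreements:
  assumes "k > 0"
  shows "card {b. b \<le> n div k \<and> (b \<in> A \<longleftrightarrow> n - k * b \<in> A)} =
           weighted_rep 1 k A n + weighted_rep 1 k (UNIV - A) n"
proof -
  have "{b. b \<le> n div k \<and> (b \<in> A \<longleftrightarrow> n - k * b \<in> A)} =
          {b. b \<le> n div k \<and> b \<in> A \<and> n - k * b \<in> A} \<union>
          {b. b \<le> n div k \<and> b \<in> UNIV - A \<and> n - k * b \<in> UNIV - A}"
    by auto
  then show ?thesis
    unfolding weighted_rep_1_eq_card[OF assms]
    by (simp only:) (rule card_Un_disjoint, auto)
qed

section \<open>Membership as a function of the base-k digits\<close>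

text \<open>Passing from \<open>n\<close> to \<open>n + k\<close> shifts the values \<open>n - k b\<close> by one index, so the two
  vanishing sums of signs differ only by a new first and a new last term.\<close>

lemma mem_iff_div_notin:
  assumes "k > 0"
    and eq: "\<And>n. n \<ge> n0 \<Longrightarrow> weighted_rep 1 k A n = weighted_rep 1 k (UNIV - A) n"
    and "x \<ge> n0 + k"
  shows "x \<in> A \<longleftrightarrow> x div k \<notin> A"
proof -
  define n where "n = x - k"
  have x: "x = n + k" and "n \<ge> n0"
    using assms(3) by (auto simp: n_def)
  have zero: "(\<Sum>b\<le>m div k. set_sign A b + set_sign A (m - k * b)) = 0" if "m \<ge> n0" for m
    using sum_set_sign_eq_weighted_rep_diff[OF assms(1), of A m] eq[OF that] by simp
  have "(\<Sum>b\<le>Suc (n div k). set_sign A b) + (\<Sum>b\<le>Suc (n div k). set_sign A (x - k * b)) = 0"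
    using zero[of x] \<open>n \<ge> n0\<close> assms(1) by (simp add: x sum.distrib)
  moreover have "(\<Sum>b\<le>Suc (n div k). set_sign A (x - k * b)) =
      set_sign A x + (\<Sum>b\<le>n div k. set_sign A (n - k * b))"
    by (subst sum.atMost_Suc_shift) (simp add: x)
  moreover have "(\<Sum>b\<le>n div k. set_sign A b) + (\<Sum>b\<le>n div k. set_sign A (n - k * b)) = 0"
    using zero[OF \<open>n \<ge> n0\<close>] by (simp add: sum.distrib)
  ultimately have "set_sign A (x div k) + set_sign A x = 0"
    using assms(1) by (simp add: x)
  then show ?thesis
    by (auto simp: set_sign_def split: if_splits)
qed

lemma mem_iff_leading_digits:
  fixes k M :: nat
  assumes "\<And>x. x \<ge> M \<Longrightarrow> x \<in> A \<longleftrightarrow> x div k \<notin> A"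
    and "x div k ^ i \<ge> M"
  shows "x \<in> A \<longleftrightarrow> (x div k ^ i \<in> A \<longleftrightarrow> even i)"
  using assms(2)
proof (induction i arbitrary: x)
  case (Suc i)
  have step: "x div k ^ Suc i = x div k div k ^ i"
    by (simp add: div_mult2_eq)
  have "x \<ge> M"
    using Suc.prems div_le_dividend le_trans by blast
  then show ?case
    using assms(1)[of x] Suc.IH[of "x div k"] Suc.prems unfolding step by simp
qed simp

section \<open>Linear growth\<close>

text \<open>The exponent \<open>i + M + 5\<close> makes the blocks near \<open>n\<close> so long that \<open>k b\<close> never exceeds their length
  while \<open>b\<close> runs through the four blocks near \<open>0\<close>: it absorbs \<open>M + 1 \<le> k ^ (M + 1)\<close>, three further
  scales, and the factor \<open>k\<close>. The factor \<open>M + 1\<close> in the bound on \<open>n\<close> keeps the quotient of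
  \<open>n - k b\<close> at least \<open>M\<close> even after crossing one block boundary.\<close>

lemma power_le_twice_weighted_rep:
  fixes k M i n :: nat
  assumes k: "k \<ge> 2" and "M > 0"
    and flip: "\<And>x. x \<ge> M \<Longrightarrow> x \<in> A \<longleftrightarrow> x div k \<notin> A"
    and eq: "weighted_rep 1 k A n = weighted_rep 1 k (UNIV - A) n"
    and n: "n \<ge> (M + 1) * k ^ (i + M + 5)"
  shows "k ^ i \<le> 2 * weighted_rep 1 k A n"
proof -
  define p where "p = k ^ (i + M + 5)"
  define block where "block j = {M * k ^ j ..< (M + 1) * k ^ j}" for j
  have "p > 0" and "k > 0"
    using k by (auto simp: p_def)
  have q: "n div p \<ge> M + 1"
    using n \<open>p > 0\<close> by (simp only: p_def less_eq_div_iff_mult_less_eq)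
  have "p \<le> n"
    using n by (simp add: p_def)

  have kb_le_p: "k * b \<le> p" if "b \<in> block j" "j \<le> i + 3" for b j
  proof -
    have "M + 1 \<le> k ^ (M + 1)"
      using k less_exp[of "M + 1"] power_mono[of 2 k "M + 1"] by linarith
    then have "k * ((M + 1) * k ^ j) \<le> k * (k ^ (M + 1) * k ^ (i + 3))"
      using that(2) k by (intro mult_le_mono power_increasing) auto
    also have "\<dots> = p"
      by (simp add: p_def power_add eval_nat_numeral mult_ac)
    finally show ?thesis
      using that(1) by (auto simp: block_def intro: order_trans[OF mult_le_mono2[OF less_imp_le]])
  qed

  \<comment> \<open>The remainder of \<open>n\<close> by \<open>p\<close> is where \<open>n - k b\<close> drops below a block boundary.\<close>
  have above: "n - k * b \<in> A \<longleftrightarrow> (n div p \<in> A \<longleftrightarrow> even (i + M + 5))" if "k * b \<le> n mod p" for b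
  proof -
    have "n - k * b = n div p * p + (n mod p - k * b)"
      using that div_mult_mod_eq[of n p] by linarith
    moreover have "n mod p - k * b < p"
      using \<open>p > 0\<close> by (simp add: less_imp_diff_less)
    ultimately have "(n - k * b) div p = n div p"
      by (simp add: div_nat_eqI)
    then show ?thesis
      using mem_iff_leading_digits[OF flip, where x = "n - k * b" and i = "i + M + 5"] q
      unfolding p_def[symmetric] by simp
  qed
  have below: "n - k * b \<in> A \<longleftrightarrow> (n div p - 1 \<in> A \<longleftrightarrow> even (i + M + 5))"
    if "n mod p < k * b" "k * b \<le> p" for b
  proof -
    have "n div p * p = (n div p - 1) * p + p"
      using q by (cases "n div p") auto
    then have "n - k * b = (n div p - 1) * p + (n mod p + p - k * b)"
      using that div_mult_mod_eq[of n p] by linarith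
    moreover have "n mod p + p - k * b < p"
      using that by linarith
    ultimately have "(n - k * b) div p = n div p - 1"
      by (simp add: div_nat_eqI)
    then show ?thesis
      using mem_iff_leading_digits[OF flip, where x = "n - k * b" and i = "i + M + 5"] q
      unfolding p_def[symmetric] by simp
  qed

  have block_mem: "b \<in> A \<longleftrightarrow> (M \<in> A \<longleftrightarrow> even j)" if "b \<in> block j" for b j
  proof -
    have "b div k ^ j = M"
      using that by (intro div_nat_eqI) (simp_all add: block_def mult.commute[of "k ^ j"])
    then show ?thesis
      using mem_iff_leading_digits[OF flip, where x = b and i = j] by simp
  qed

  have parity: "\<exists>j\<in>{m, m + 1}. even j \<longleftrightarrow> P" for m :: nat and P
    by (cases "even m \<longleftrightarrow> P") auto
  have agreeing_block: "\<exists>j\<ge>i. j \<le> i + 3 \<and> (\<forall>b\<in>block j. b \<in> A \<longleftrightarrow> n - k * b \<in> A)"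
  proof (cases "k * (M * k ^ (i + 2)) \<le> n mod p")
    case True
    have first: "k * b \<le> n mod p" if "b \<in> block j" "j \<le> i + 1" for b j
    proof -
      have "b \<le> (M + 1) * k ^ j"
        using that(1) by (simp add: block_def)
      also have "\<dots> \<le> (M + 1) * k ^ (i + 1)"
        using that(2) k by (intro mult_le_mono2 power_increasing) auto
      \<comment> \<open>\<open>M + 1 \<le> 2 M \<le> M k\<close>: consecutive blocks do not overlap.\<close>
      also have "\<dots> \<le> (M * k) * k ^ (i + 1)"
        using k \<open>M > 0\<close> mult_le_mono2[of 2 k M] by (intro mult_le_mono1) linarith
      also have "\<dots> = M * k ^ (i + 2)"
        by simp
      finally show ?thesis
        using True by (meson le_trans mult_le_mono2)
    qed
    obtain j where j: "j \<in> {i, i + 1}"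
      and sign: "even j \<longleftrightarrow> (M \<in> A \<longleftrightarrow> (n div p \<in> A \<longleftrightarrow> even (i + M + 5)))"
      using parity by blast
    have "j \<ge> i" "j \<le> i + 1"
      using j by auto
    moreover have "b \<in> A \<longleftrightarrow> n - k * b \<in> A" if b: "b \<in> block j" for b
      unfolding block_mem[OF b] above[OF first[OF b \<open>j \<le> i + 1\<close>]] using sign by argo
    ultimately show ?thesis
      by (intro exI[of _ j]) simp
  next
    case False
    have last: "n mod p < k * b" if "b \<in> block j" "j \<ge> i + 2" for b j
    proof -
      have "M * k ^ (i + 2) \<le> M * k ^ j"
        using that(2) k by (intro mult_le_mono2 power_increasing) auto
      also have "\<dots> \<le> b"
        using that(1) by (simp add: block_def)
      finally show ?thesis
        using False by (meson le_trans mult_le_mono2 not_le)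
    qed
    obtain j where j: "j \<in> {i + 2, i + 2 + 1}"
      and sign: "even j \<longleftrightarrow> (M \<in> A \<longleftrightarrow> (n div p - 1 \<in> A \<longleftrightarrow> even (i + M + 5)))"
      using parity by blast
    have "j \<ge> i + 2" "j \<le> i + 3"
      using j by auto
    moreover have "b \<in> A \<longleftrightarrow> n - k * b \<in> A" if b: "b \<in> block j" for b
      unfolding block_mem[OF b] below[OF last[OF b \<open>j \<ge> i + 2\<close>] kb_le_p[OF b \<open>j \<le> i + 3\<close>]]
      using sign by argo
    ultimately show ?thesis
      by (intro exI[of _ j]) simp
  qed
  then obtain j where j: "j \<ge> i" "j \<le> i + 3" "\<forall>b\<in>block j. b \<in> A \<longleftrightarrow> n - k * b \<in> A"
    by blast

  have "block j \<subseteq> {b. b \<le> n div k \<and> (b \<in> A \<longleftrightarrow> n - k * b \<in> A)}"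
  proof
    fix b assume b: "b \<in> block j"
    have "k * b \<le> n"
      using kb_le_p[OF b j(2)] \<open>p \<le> n\<close> by simp
    then show "b \<in> {b. b \<le> n div k \<and> (b \<in> A \<longleftrightarrow> n - k * b \<in> A)}"
      using b j(3) \<open>k > 0\<close> by (auto simp: less_eq_div_iff_mult_less_eq mult.commute)
  qed
  then have "card (block j) \<le> card {b. b \<le> n div k \<and> (b \<in> A \<longleftrightarrow> n - k * b \<in> A)}"
    by (rule card_mono[rotated]) simp
  moreover have "card (block j) = k ^ j"
    by (simp add: block_def)
  moreover have "k ^ i \<le> k ^ j"
    using j(1) k by (simp add: power_increasing)
  ultimately show ?thesis
    using card_agreements[OF \<open>k > 0\<close>, of n A] eq by simp
qed

lemma weighted_rep_linear_lower_bound: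
  fixes k n0 :: nat and A :: "nat set"
  assumes "k \<ge> 2"
    and eq: "\<And>n. n \<ge> n0 \<Longrightarrow> weighted_rep 1 k A n = weighted_rep 1 k (UNIV - A) n"
  shows "\<exists>C>0. \<exists>N. \<forall>n\<ge>N. n \<le> C * weighted_rep 1 k A n"
proof -
  define M where "M = n0 + k"
  define L where "L = (M + 1) * k ^ (M + 5)"
  have "M > 0" "L > 0"
    using assms(1) by (auto simp: M_def L_def)
  have flip: "x \<in> A \<longleftrightarrow> x div k \<notin> A" if "x \<ge> M" for x
    using mem_iff_div_notin[of k n0 A x] assms that by (simp add: M_def)
  have "n \<le> 2 * L * k * weighted_rep 1 k A n" if n: "n \<ge> n0 + L" for n
  proof -
    have "n div L \<ge> 1"
      using n \<open>L > 0\<close> by (simp add: div_greater_zero_iff Suc_le_eq)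
    then obtain i where i: "k ^ i \<le> n div L" "n div L < k ^ (i + 1)"
      using ex_power_ivl1[OF assms(1)] by blast
    have "(M + 1) * k ^ (i + M + 5) = k ^ i * L"
      by (simp only: L_def power_add ac_simps)
    also have "\<dots> \<le> n"
      using i(1) \<open>L > 0\<close> by (simp add: less_eq_div_iff_mult_less_eq)
    finally have "k ^ i \<le> 2 * weighted_rep 1 k A n"
      using n by (intro power_le_twice_weighted_rep[OF assms(1) \<open>M > 0\<close> flip eq]) auto
    then have "L * k * k ^ i \<le> L * k * (2 * weighted_rep 1 k A n)"
      by (rule mult_le_mono2)
    moreover have "n \<le> L * k * k ^ i"
      using i(2) \<open>L > 0\<close> by (simp add: div_less_iff_less_mult mult_ac)
    ultimately have "n \<le> L * k * (2 * weighted_rep 1 k A n)"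
      by (rule le_trans[rotated])
    then show ?thesis
      by (simp only: ac_simps)
  qed
  moreover have "2 * L * k > 0"
    using \<open>L > 0\<close> assms(1) by simp
  ultimately show ?thesis
    by blast
qed

theorem theorem1p1:
  fixes k n0 :: nat and A :: "nat set"
  assumes "k \<ge> 2"
    and "\<And>n. n \<ge> n0 \<Longrightarrow> weighted_rep 1 k A n = weighted_rep 1 k (UNIV - A) n"
  shows "\<exists>c::real. c > 0 \<and>
           (\<exists>N::nat. \<forall>n\<ge>N. real (weighted_rep 1 k A n) \<ge> c * ln (real n))"
proof -
  obtain C N where "C > 0" and bound: "\<And>n. n \<ge> N \<Longrightarrow> n \<le> C * weighted_rep 1 k A n"
    using weighted_rep_linear_lower_bound[OF assms] by blast
  have "real (weighted_rep 1 k A n) \<ge> 1 / real C * ln (real n)" if "n \<ge> N + 1" for n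
  proof -
    have "ln (real n) \<le> real n"
      using that by (intro less_imp_le ln_less_self) simp
    also have "\<dots> \<le> real C * real (weighted_rep 1 k A n)"
      using bound[of n] that by (metis add_leD1 of_nat_le_iff of_nat_mult)
    finally show ?thesis
      using \<open>C > 0\<close> by (simp add: field_simps)
  qed
  then show ?thesis
    using \<open>C > 0\<close> by (intro exI[of _ "1 / real C"]) auto
qed

end
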